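(* Let $c>\left(\frac{4\pi}3\right)^{1/4}$. There exists a set of nonnegative integers $A$ such that $A^2+A^2=\mathbb{N}_0$ and $A(X)\sim \frac{2c\sqrt{X}}{(\log X)^{1/4}}$ as $X\to\infty$.
   Context: $\mathbb{N}_0$ is the set of nonnegative integers. $A^2=\{ab:a,b\in A\}$, $A^2+A^2=\{x+y: x,y\in A^2\}$. $A(X)=|A\cap[1,X]|$. *)

theory Defs
  imports "HOL-Analysis.Analysis" "HOL-Library.Landau_Symbols"
begin

definition prodset :: "nat set \<Rightarrow> nat set" where
  "prodset A = {a * b | a b. a \<in> A \<and> b \<in> A}"

definition sumset :: "nat set \<Rightarrow> nat set \<Rightarrow> nat set" where
  "sumset B C = {x + y | x y. x \<in> B \<and> y \<in> C}"

definition countfn :: "nat set \<Rightarrow> real \<Rightarrow> nat" where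
  "countfn A X = card {n \<in> A. 1 \<le> n \<and> real n \<le> X}"

end

theory Submission
  imports Defs "HOL-Probability.Probability" "HOL-Real_Asymp.Real_Asymp"
begin

text \<open>
  It suffices to find a set \<open>A0\<close> with \<open>A0 (X) = o (sqrt X / (ln X) powr (1/4))\<close> such that every
  superset \<open>A\<close> of \<open>A0\<close> satisfies \<open>A\<^sup>2 + A\<^sup>2 = UNIV\<close>, since any set with the required count can then be
  added to it.

  Let \<open>s\<close> be about \<open>k powr (2/7)\<close>. Near \<open>4 ^ k\<close> the set \<open>A0\<close> contains an interval of length about
  \<open>2 ^ k / s\<close>, so it is enough that the products of two elements meet every window of half that length
  at height \<open>4 ^ k\<close>. It also contains a progression of step about \<open>2 ^ k * s\<close> and one random point
  from each of the blocks of that length. A product of a progression element near \<open>4 ^ i\<close>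
  and a random point near \<open>4 ^ (k - i)\<close> lies in a given window with expected multiplicity of
  order \<open>1 / s ^ 3\<close>; as \<open>i\<close> varies, this adds up to a positive power of \<open>k\<close>. The choices in
  different blocks are independent, and the factors leading to a given window are distinct, so a window is
  missed with probability at most \<open>exp (- k powr (1/7) / C)\<close>. The missed windows are therefore so few
  that the left end point of each of them can be added to \<open>A0\<close> as well.
\<close>

subsection \<open>Random selection\<close>

text \<open>First moment argument: with \<open>f i\<close> independent and uniform on
  \<open>B i\<close>, the product in \<open>e\<close> is the probability that \<open>t\<close> is
  missed at stage \<open>k\<close>. By \<open>sm\<close> the weighted total of misses over all
  \<open>k\<close> has finite expectation, so a single \<open>f\<close> makes it finite, and this
  total bounds every stage.\<close>

lemma exists_selection_few_misses:
  fixes B :: "'i \<Rightarrow> 'b set" and S :: "nat \<Rightarrow> 't \<Rightarrow> 'b set" and T :: "nat \<Rightarrow> 't set"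
    and J :: "nat \<Rightarrow> 'i set" and w e :: "nat \<Rightarrow> real"
  assumes B: "\<And>i. finite (B i)" "\<And>i. B i \<noteq> {}"
    and fin: "\<And>k. finite (T k)" "\<And>k. finite (J k)"
    and e: "\<And>k t. t \<in> T k \<Longrightarrow> (\<Prod>i\<in>J k. 1 - real (card (B i \<inter> S k t)) / real (card (B i))) \<le> e k"
    and nonneg: "\<And>k. 0 \<le> w k" "\<And>k. 0 \<le> e k"
    and sm: "summable (\<lambda>k. w k * (real (card (T k)) * e k))"
  shows "\<exists>f C. (\<forall>i. f i \<in> B i) \<and> (\<forall>k. w k * real (card {t\<in>T k. \<forall>i\<in>J k. f i \<notin> S k t}) \<le> C)"
proof -
  define M where "M i = uniform_count_measure (B i)" for i
  define P where "P = PiM UNIV M"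
  have prob: "prob_space (M i)" for i
    unfolding M_def by (rule prob_space_uniform_count_measure) (use B in auto)
  interpret product_prob_space M UNIV
    by (simp add: product_prob_space_def product_prob_space_axioms_def product_sigma_finite_def prob
        prob_space_imp_sigma_finite)
  \<comment> \<open>The event that \<open>t\<close> is missed at stage \<open>k\<close>. Writing
    \<open>B i - S k t\<close> makes each constraint a measurable set of \<open>M i\<close>, whose
    sets are the subsets of \<open>B i\<close>.\<close>
  define E where "E k t = {f\<in>space P. \<forall>i\<in>J k. f i \<in> B i - S k t}" for k t
  have sets_M: "B i - X \<in> sets (M i)" for i X
    by (simp add: M_def sets_uniform_count_measure)
  have E_sets: "E k t \<in> sets P" for k t
    unfolding E_def
  proof (rule sets.sets_Collect_finite_All[OF _ fin(2)])
    fix i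
    have "(\<lambda>f. f i) -` (B i - S k t) \<inter> space P \<in> sets P"
      unfolding P_def by (rule measurable_sets[OF measurable_component_singleton[of i UNIV M] sets_M[of i]]) simp
    then show "{f \<in> space P. f i \<in> B i - S k t} \<in> sets P"
      by (simp add: vimage_def Int_def conj_commute)
  qed
  have E_measure: "emeasure P (E k t) = ennreal (\<Prod>i\<in>J k. 1 - real (card (B i \<inter> S k t)) / real (card (B i)))"
    for k t
  proof -
    have "emeasure (M i) (B i - S k t) = ennreal (1 - real (card (B i \<inter> S k t)) / real (card (B i)))" for i
    proof -
      have "card (B i) = card (B i \<inter> S k t) + card (B i - S k t)"
        using B(1)[of i] by (metis Int_Diff_Un Int_Diff_disjoint card_Un_disjoint finite_Diff finite_Int)
      then have "real (card (B i - S k t)) = real (card (B i)) - real (card (B i \<inter> S k t))"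
        by simp
      moreover have "card (B i) \<noteq> 0" using B by simp
      ultimately have "1 - real (card (B i \<inter> S k t)) / real (card (B i)) = real (card (B i - S k t)) / real (card (B i))"
        by (simp add: diff_divide_distrib)
      then show ?thesis
        unfolding M_def using B(1) by (simp add: emeasure_uniform_count_measure)
    qed
    moreover have "0 \<le> 1 - real (card (B i \<inter> S k t)) / real (card (B i))" for i
      using card_mono[OF B(1)[of i], of "B i \<inter> S k t"] by (simp add: divide_le_eq)
    ultimately show ?thesis
      unfolding E_def P_def using fin(2)[of k] sets_M
      by (subst emeasure_PiM_Collect) (auto simp: prod_ennreal)
  qed
  define H where "H f = (\<Sum>k. \<Sum>t\<in>T k. ennreal (w k) * indicator (E k t) f)" for f
  have meas: "(\<lambda>f. ennreal (w k) * indicator (E k t) f) \<in> borel_measurable P" for k t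
    using E_sets by measurable
  have "integral\<^sup>N P H = (\<Sum>k. \<Sum>t\<in>T k. ennreal (w k) * emeasure P (E k t))"
    unfolding H_def using meas E_sets
    by (subst nn_integral_suminf) (auto simp: nn_integral_sum nn_integral_cmult_indicator)
  also have "\<dots> \<le> (\<Sum>k. ennreal (w k * (real (card (T k)) * e k)))"
  proof (intro suminf_le)
    fix k
    have "(\<Sum>t\<in>T k. ennreal (w k) * emeasure P (E k t)) \<le> (\<Sum>t\<in>T k. ennreal (w k * e k))"
      using e nonneg by (intro sum_mono) (auto simp: E_measure ennreal_mult intro!: mult_left_mono ennreal_leI)
    also have "\<dots> = ennreal (w k * (real (card (T k)) * e k))"
      using nonneg by (subst sum_ennreal) (auto simp: algebra_simps)
    finally show "(\<Sum>t\<in>T k. ennreal (w k) * emeasure P (E k t)) \<le> ennreal (w k * (real (card (T k)) * e k))" .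
  qed auto
  also have "\<dots> = ennreal (\<Sum>k. w k * (real (card (T k)) * e k))"
    using nonneg sm by (intro suminf_ennreal2) auto
  finally have fin_int: "integral\<^sup>N P H \<noteq> \<infinity>"
    by (auto simp: top_unique)
  have "H \<in> borel_measurable P"
    unfolding H_def using meas by measurable
  from nn_integral_noteq_infinite[OF this fin_int] have "AE f in P. H f \<noteq> \<infinity> \<and> f \<in> space P"
    by simp
  moreover have "prob_space P" unfolding P_def by (rule prob_space_PiM) (rule prob)
  ultimately obtain f where f: "H f \<noteq> \<infinity>" "f \<in> space P"
    using eventually_happens'[OF prob_space.ae_filter_bot] by blast
  have fB: "f i \<in> B i" for i
    using f(2) by (auto simp: P_def space_PiM M_def PiE_iff space_uniform_count_measure)
  have "w k * real (card {t\<in>T k. \<forall>i\<in>J k. f i \<notin> S k t}) \<le> enn2real (H f)" for k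
  proof -
    have "(\<Sum>t\<in>T k. ennreal (w k) * indicator (E k t) f) \<le> H f"
      unfolding H_def using sum_le_suminf[of "\<lambda>k. \<Sum>t\<in>T k. ennreal (w k) * indicator (E k t) f" "{k}"] by auto
    moreover have "(\<Sum>t\<in>T k. ennreal (w k) * indicator (E k t) f)
        = (\<Sum>t\<in>T k. if \<forall>i\<in>J k. f i \<notin> S k t then ennreal (w k) else 0)"
      using f(2) fB by (intro sum.cong) (auto simp: E_def)
    moreover have "\<dots> = ennreal (w k * real (card {t\<in>T k. \<forall>i\<in>J k. f i \<notin> S k t}))"
      using fin(1)[of k] nonneg
      by (simp add: sum.If_cases ennreal_mult Int_def mult.commute ennreal_of_nat_eq_real_of_nat)
    ultimately have "ennreal (w k * real (card {t\<in>T k. \<forall>i\<in>J k. f i \<notin> S k t})) \<le> H f" by simp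
    from enn2real_mono[OF this] show ?thesis
      using f(1) nonneg(1)[of k] by (simp add: top.not_eq_extremum)
  qed
  with fB show ?thesis by blast
qed

subsection \<open>Thin sets at the scales \<open>4 ^ k\<close>\<close>

text \<open>
  \<open>2 ^ slow k\<close> is \<open>k powr (2/7)\<close> up to a factor 2. The exponent has to exceed 1/4, so that
  about \<open>len k\<close> elements of size \<open>4 ^ k\<close> are negligible in the required count, and to be below 1/3,
  so that the expected number of hits of a window, about \<open>k / (2 ^ slow k) ^ 3\<close>, is a positive
  power of \<open>k\<close>. Powers of 2 make all the divisions exact.
\<close>

definition slow :: "nat \<Rightarrow> nat" where
  "slow k = nat \<lfloor>2/7 * log 2 (real (k + 1))\<rfloor>"

definition len :: "nat \<Rightarrow> nat" where "len k = 2 ^ (k - slow k)"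
definition gap :: "nat \<Rightarrow> nat" where "gap k = 2 ^ (k + slow k)"

lemma slow_upper: "2 ^ slow k \<le> real (k + 1) powr (2/7)"
  and slow_lower: "real (k + 1) powr (2/7) \<le> 2 * 2 ^ slow k"
proof -
  define x where "x = 2/7 * log 2 (real (k + 1))"
  have x: "x \<ge> 0" "2 powr x = real (k + 1) powr (2/7)"
    unfolding x_def by (simp_all add: powr_def log_def)
  have s: "real (slow k) \<le> x" "x \<le> real (slow k) + 1"
    using x(1) unfolding slow_def x_def[symmetric] by linarith+
  have "2 powr real (slow k) \<le> 2 powr x" "2 powr x \<le> 2 powr (real (slow k) + 1)"
    using s by auto
  then show "2 ^ slow k \<le> real (k + 1) powr (2/7)" "real (k + 1) powr (2/7) \<le> 2 * 2 ^ slow k"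
    by (simp_all add: x powr_realpow powr_add mult.commute)
qed

lemma slow_mono: "i \<le> j \<Longrightarrow> slow i \<le> slow j"
  unfolding slow_def by (intro nat_mono floor_mono mult_left_mono) auto

lemma slow_le: "slow k \<le> k"
proof -
  have "2 ^ slow k \<le> real (k + 1) powr (2/7)" by (rule slow_upper)
  also have "\<dots> \<le> real (k + 1) powr 1" by (intro powr_mono) auto
  also have "\<dots> \<le> 2 ^ k"
    using of_nat_mono[of "Suc k" "2 ^ k", where ?'a = real] Suc_leI[OF less_exp[of k]] by simp
  finally show ?thesis by simp
qed

lemma slow_le_powr: "real (slow k) \<le> real (k + 1) powr (2/7)"
  using slow_upper[of k] of_nat_less_two_power[of "slow k", where ?'a = real] by linarith

lemma real_len: "real (len k) = 2 ^ k / 2 ^ slow k"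
  using power_diff[OF _ slow_le, of "2::real" k] by (simp add: len_def)

lemma real_gap: "real (gap k) = 2 ^ k * 2 ^ slow k"
  by (simp add: gap_def power_add)

lemma len_pos [simp]: "0 < len k" and gap_pos [simp]: "0 < gap k"
  by (simp_all add: len_def gap_def)

lemma len_mult_gap: "len k * gap k = 4 ^ k"
proof -
  have "k - slow k + (k + slow k) = 2 * k" using slow_le[of k] by simp
  then have "len k * gap k = 2 ^ (2 * k)"
    by (simp add: len_def gap_def flip: power_add)
  then show ?thesis by (simp add: power_mult)
qed

lemma len_le: "len k \<le> 2 ^ k"
  by (simp add: len_def)

lemma gap_mono: "i \<le> j \<Longrightarrow> gap i \<le> gap j"
  using slow_mono[of i j] by (simp add: gap_def)

text \<open>The number of windows divided by \<open>len k\<close> has order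
  \<open>k powr (4/7)\<close>, which the exponential of a negative multiple of
  \<open>k powr (1/7)\<close> outweighs. The weight \<open>1 / len k\<close> is there to make the
  missed windows number at most a constant times \<open>len k\<close>.\<close>

lemma summable_miss_probability:
  "summable (\<lambda>k. 1 / real (len k) * (real (card {gap k..<16 * gap k}) *
     exp (- (3 / 16 / (2 ^ slow k) ^ 3 * ((real k - real (slow k)) / 2 - 2)))))"
proof (rule summable_comparison_test_ev)
  define h where "h x = 15 * (x + 1) powr (4/7) * exp (- (3 / 16 / ((x + 1) powr (2/7)) ^ 3 * ((x - (x + 1) powr (2/7)) / 2 - 2)))" for x :: real
  \<comment> \<open>Nonnegativity of this factor justifies replacing \<open>2 ^ slow k\<close> and
    \<open>slow k\<close> by the larger \<open>(k + 1) powr (2/7)\<close>.\<close>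
  have pos: "eventually (\<lambda>x::real. (x - (x + 1) powr (2/7)) / 2 - 2 \<ge> 0) at_top"
    by real_asymp
  have "eventually (\<lambda>x::real. h x \<le> 1 / x ^ 2) at_top"
    unfolding h_def by real_asymp
  with pos have "eventually (\<lambda>x::real. h x \<le> 1 / x ^ 2 \<and> (x - (x + 1) powr (2/7)) / 2 - 2 \<ge> 0) at_top"
    by (rule eventually_conj[rotated])
  then have ev: "eventually (\<lambda>k. h (real k) \<le> 1 / real k ^ 2 \<and> (real k - (real k + 1) powr (2/7)) / 2 - 2 \<ge> 0) sequentially"
    by (rule eventually_compose_filterlim[OF _ filterlim_real_sequentially])
  then show "\<forall>\<^sub>F k in sequentially. norm (1 / real (len k) * (real (card {gap k..<16 * gap k}) *
     exp (- (3 / 16 / (2 ^ slow k) ^ 3 * ((real k - real (slow k)) / 2 - 2))))) \<le> 1 / real k ^ 2"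
  proof eventually_elim
    case (elim k)
    let ?s = "2 ^ slow k :: real" and ?p = "(real k + 1) powr (2/7)"
    have s: "?s \<le> ?p" "real (slow k) \<le> ?p"
      using slow_upper[of k] slow_le_powr[of k] by (simp_all add: add.commute)
    have "1 / real (len k) * real (card {gap k..<16 * gap k}) = 15 * ?s ^ 2"
      by (simp add: real_len real_gap power2_eq_square)
    also have "\<dots> \<le> 15 * ?p ^ 2"
      using s by (intro mult_left_mono power_mono) auto
    also have "?p ^ 2 = (real k + 1) powr (4/7)"
      by (simp add: powr_power)
    finally have 1: "1 / real (len k) * real (card {gap k..<16 * gap k}) \<le> 15 * (real k + 1) powr (4/7)" .
    have "3 / 16 / ?p ^ 3 * ((real k - ?p) / 2 - 2) \<le> 3 / 16 / ?s ^ 3 * ((real k - real (slow k)) / 2 - 2)"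
      using s elim by (intro mult_mono divide_left_mono power_mono) auto
    then have "1 / real (len k) * real (card {gap k..<16 * gap k}) *
     exp (- (3 / 16 / ?s ^ 3 * ((real k - real (slow k)) / 2 - 2))) \<le> h (real k)"
      unfolding h_def by (intro mult_mono 1) auto
    with elim show ?case
      by (simp add: mult.assoc)
  qed
  show "summable (\<lambda>k. 1 / real k ^ 2)"
    using inverse_power_summable[of 2, where ?'a = real] by (simp add: inverse_eq_divide)
qed

text \<open>The terms grow almost like \<open>2 ^ k\<close>, so the last ones dominate. The constant
  8 closes the induction: passing from \<open>?p\<close> to \<open>?q\<close> costs a factor 3/2,
  the new term is at most \<open>4 * 2 ^ n / ?q\<close>, and 12 + 4 = 16.\<close>

lemma sum_len_le: "(\<Sum>k\<le>n. real (len k)) \<le> 8 * 2 ^ n / real (n + 1) powr (2/7)"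
proof (induction n)
  case 0
  then show ?case by (simp add: len_def)
next
  case (Suc n)
  let ?p = "real (n + 1) powr (2/7)" and ?q = "real (Suc n + 1) powr (2/7)"
  have q0: "0 < ?q" "0 < ?p" by auto
  have "real (Suc n + 1) / real (n + 1) \<le> 2" by (simp add: field_simps)
  then have "(real (Suc n + 1) / real (n + 1)) powr (2/7) \<le> 2 powr (2/7)"
    by (intro powr_mono2) auto
  \<comment> \<open>Seventh powers are compared: 4 against \<open>(3/2) ^ 7 > 17\<close>.\<close>
  also have "\<dots> \<le> (3/2 :: real)"
  proof (rule power_le_imp_le_base[where n = 6])
    have "(2 powr (2/7)) ^ Suc 6 = (4::real)" by (simp add: powr_power)
    moreover have "(1::real) \<le> 2 powr (2/7)" by (simp add: ge_one_powr_ge_zero)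
    ultimately show "(2 powr (2/7)) ^ Suc 6 \<le> (3/2 :: real) ^ Suc 6" by (simp add: power_divide)
  qed auto
  finally have ratio: "?q \<le> 3/2 * ?p"
    using q0 by (simp add: powr_divide divide_le_eq)
  have "8 * 2 ^ n / ?p \<le> 8 * 2 ^ n * (3/2) / ?q"
    using ratio q0 by (simp add: field_simps)
  moreover have "real (len (Suc n)) \<le> 2 ^ Suc n * 2 / ?q"
    using slow_lower[of "Suc n"] q0 by (simp add: real_len field_simps)
  ultimately have "(\<Sum>k\<le>Suc n. real (len k)) \<le> 8 * 2 ^ n * (3/2) / ?q + 2 ^ Suc n * 2 / ?q"
    using Suc by simp
  also have "\<dots> = 8 * 2 ^ Suc n / ?q" by (simp add: field_simps)
  finally show ?case .
qed

section \<open>Blocks, progressions and windows at each scale\<close>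

text \<open>Level and position form one index, so that all levels share a single family of
  independent choices.\<close>

definition blk :: "nat \<times> nat \<Rightarrow> nat set" where
  "blk p = {snd p * gap (fst p)..<(snd p + 1) * gap (fst p)}"

definition slots :: "nat \<Rightarrow> nat set" where
  "slots k = {len k..<4 * len k}"

text \<open>
  For \<open>r \<in> slots k\<close> the blocks \<open>blk (k, r)\<close> partition \<open>{4 ^ k..<4 ^ Suc k}\<close>, and \<open>windows k\<close>
  indexes intervals \<open>{t * len k..<(t + 1) * len k}\<close> that partition \<open>{4 ^ k..<16 * 4 ^ k}\<close>.
\<close>

definition starts :: "nat \<Rightarrow> nat set" where
  "starts k = (\<lambda>r. r * gap k) ` slots k"

definition windows :: "nat \<Rightarrow> nat set" where
  "windows k = {gap k..<16 * gap k}"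

definition quots :: "nat \<Rightarrow> nat \<Rightarrow> nat \<Rightarrow> nat set" where
  "quots k t a = {b. t * len k \<le> a * b \<and> a * b < (t + 1) * len k}"

text \<open>Scales of the smaller factor. The upper bound says \<open>4 ^ Suc i \<le> len k\<close>,
  so that each \<open>a \<in> starts i\<close> has a multiple in every window; the lower bound keeps
  the cofactor at level at most \<open>k\<close>.\<close>

definition lows :: "nat \<Rightarrow> nat set" where
  "lows k = {i. 1 \<le> i \<and> 2 * i + 2 \<le> k - slow k}"

definition hits :: "nat \<Rightarrow> nat \<Rightarrow> nat set" where
  "hits k t = (\<Union>i\<in>lows k. \<Union>a\<in>starts i. quots k t a)"

text \<open>The base 4 logarithm rounded down, with value 0 at \<open>b = 0\<close>.\<close>

definition level :: "nat \<Rightarrow> nat" where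
  "level b = (LEAST j. b < 4 ^ Suc j)"

lemma level_le: "b < 4 ^ Suc n \<Longrightarrow> level b \<le> n"
  unfolding level_def by (rule Least_le)

lemma less_power_level: "b < 4 ^ Suc (level b)"
proof -
  have "b < 4 ^ Suc b"
    by (rule less_le_trans[OF less_exp[of b]]) (rule order_trans[OF power_mono[of 2 "4::nat" b]], auto)
  then show ?thesis unfolding level_def by (rule LeastI)
qed

lemma power_level_le:
  assumes "1 \<le> b" shows "4 ^ level b \<le> b"
proof (cases "level b")
  case (Suc j)
  then have "\<not> b < 4 ^ Suc j"
    using not_less_Least[of j "\<lambda>j. b < 4 ^ Suc j"] by (simp add: level_def)
  with Suc show ?thesis by simp
qed (use assms in simp)

lemma level_eqI:
  assumes "4 ^ j \<le> b" "b < 4 ^ Suc j" shows "level b = j"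
proof (rule antisym)
  show "level b \<le> j" using assms level_le by blast
  have "(4::nat) ^ j < 4 ^ Suc (level b)" using assms(1) less_power_level[of b] by linarith
  then show "j \<le> level b" by (simp only: power_strict_increasing_iff less_Suc_eq_le)
qed

lemma blk_bounds:
  assumes "r \<in> slots j" "b \<in> blk (j, r)"
  shows "4 ^ j \<le> b" "b < 4 ^ Suc j"
proof -
  have "len j * gap j \<le> r * gap j" "(r + 1) * gap j \<le> (4 * len j) * gap j"
    using assms(1) by (intro mult_le_mono1; simp add: slots_def)+
  with assms(2) show "4 ^ j \<le> b" "b < 4 ^ Suc j"
    using len_mult_gap[of j] by (auto simp: blk_def)
qed

lemma level_blk: "r \<in> slots j \<Longrightarrow> b \<in> blk (j, r) \<Longrightarrow> level b = j"
  using blk_bounds level_eqI by blast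

lemma mem_blk: "b \<in> blk (j, b div gap j)"
  using dividend_less_div_times[of "gap j" b] by (simp add: blk_def)

lemma mem_blk_unique: "b \<in> blk (j, r) \<Longrightarrow> r = b div gap j"
  by (rule sym, rule div_nat_eqI) (simp_all add: blk_def algebra_simps)

lemma div_gap_in_slots:
  assumes "1 \<le> b" shows "b div gap (level b) \<in> slots (level b)"
proof -
  have "len (level b) * gap (level b) \<le> b"
    using power_level_le[OF assms] by (simp add: len_mult_gap)
  then have 1: "len (level b) \<le> b div gap (level b)"
    by (simp add: less_eq_div_iff_mult_less_eq)
  have "b < (4 * len (level b)) * gap (level b)"
    using less_power_level[of b] len_mult_gap[of "level b"] by (simp add: mult.assoc)
  then have "b div gap (level b) < 4 * len (level b)"
    by (simp add: div_less_iff_less_mult)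
  with 1 show ?thesis by (simp add: slots_def)
qed

lemma finite_blk [simp]: "finite (blk p)" and card_blk: "card (blk p) = gap (fst p)"
  by (simp_all add: blk_def algebra_simps)

lemma blk_nonempty: "blk p \<noteq> {}"
  by (simp add: blk_def)

lemma starts_bounds:
  assumes "a \<in> starts i" shows "4 ^ i \<le> a" "a < 4 ^ Suc i"
proof -
  from assms obtain r where r: "r \<in> slots i" "a = r * gap i" by (auto simp: starts_def)
  then have "a \<in> blk (i, r)" by (simp add: blk_def)
  with r show "4 ^ i \<le> a" "a < 4 ^ Suc i" using blk_bounds by blast+
qed

lemma card_starts: "card (starts i) = 3 * len i"
  unfolding starts_def by (subst card_image) (auto simp: inj_on_def slots_def gap_def)

lemma finite_starts [simp]: "finite (starts i)" and finite_slots [simp]: "finite (slots i)"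
  by (simp_all add: starts_def slots_def)

lemma finite_lows [simp]: "finite (lows k)"
  by (rule finite_subset[of _ "{..k}"]) (auto simp: lows_def)

lemma starts_le_len:
  assumes "i \<in> lows k" "a \<in> starts i" shows "a \<le> len k"
proof -
  have "a < 4 ^ Suc i" by (rule starts_bounds) fact
  also have "(4::nat) ^ Suc i = 2 ^ (2 * Suc i)" by (simp add: power_mult)
  also have "\<dots> \<le> len k"
    unfolding len_def using assms(1) by (intro power_increasing) (auto simp: lows_def)
  finally show ?thesis by simp
qed

section \<open>Cofactors leading to a window, and the expected number of hits\<close>

text \<open>A window contains at least \<open>len k div a\<close> multiples of \<open>a\<close>, and
  rounding down a quotient that is at least 1 loses at most a factor 2.\<close>

lemma card_quots_ge:
  assumes "1 \<le> a" "a \<le> len k"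
  shows "real (len k) / (2 * real a) \<le> real (card (quots k t a))" "finite (quots k t a)"
proof -
  \<comment> \<open>\<open>?q\<close> is \<open>t * len k / a\<close> rounded up, the least cofactor
    that reaches the window.\<close>
  let ?q = "(t * len k + a - 1) div a" and ?n = "len k div a"
  show fin: "finite (quots k t a)"
  proof (rule finite_subset)
    show "quots k t a \<subseteq> {..(t + 1) * len k}"
    proof
      fix b assume "b \<in> quots k t a"
      moreover have "1 * b \<le> a * b" using assms(1) by (intro mult_le_mono1)
      ultimately have "b \<le> (t + 1) * len k" unfolding quots_def by (simp only: mem_Collect_eq) linarith
      then show "b \<in> {..(t + 1) * len k}" by simp
    qed
  qed simp
  have "{?q..<?q + ?n} \<subseteq> quots k t a"
  proof
    fix b assume "b \<in> {?q..<?q + ?n}"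
    then have b: "?q \<le> b" "b + 1 \<le> ?q + ?n" by auto
    have "t * len k + a - 1 < a * (?q + 1)"
      using assms(1) dividend_less_times_div[of a "t * len k + a - 1"] by simp
    then have "t * len k \<le> a * ?q" using assms(1) by simp
    also have "\<dots> \<le> a * b" using b(1) by (rule mult_le_mono2)
    finally have 1: "t * len k \<le> a * b" .
    have "a * b + a \<le> a * (?q + ?n)"
      using mult_le_mono2[OF b(2), of a] by simp
    also have "\<dots> = a * ?q + a * ?n" by (rule distrib_left)
    also have "\<dots> \<le> (t * len k + a - 1) + len k"
      by (intro add_mono times_div_less_eq_dividend)
    finally have "a * b < (t + 1) * len k" using assms(1) by simp
    with 1 show "b \<in> quots k t a" by (simp add: quots_def)
  qed
  from card_mono[OF fin this] have "?n \<le> card (quots k t a)"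
    by simp
  moreover have "real (len k) / (2 * real a) \<le> real ?n"
  proof -
    have "1 \<le> ?n" using assms div_le_mono[OF assms(2), of a] by simp
    then have "a \<le> a * ?n" by simp
    moreover have "len k < a * ?n + a" using assms(1) dividend_less_times_div[of a "len k"] by simp
    ultimately have "len k \<le> 2 * (a * ?n)" by linarith
    then have "real (len k) \<le> 2 * (real a * real ?n)"
      by (metis of_nat_le_iff of_nat_mult of_nat_numeral)
    then show ?thesis using assms(1) by (simp add: divide_le_eq algebra_simps)
  qed
  ultimately show "real (len k) / (2 * real a) \<le> real (card (quots k t a))" by linarith
qed

text \<open>The product lies between \<open>4 ^ k\<close> and \<open>16 * 4 ^ k\<close>. Dividing by
  \<open>a \<le> len k\<close> gives the first bound, which separates the cofactors of different
  \<open>a\<close>; dividing by \<open>a \<ge> 4 ^ i\<close> gives the second, which limits the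
  length of the block containing \<open>b\<close>.\<close>

lemma quots_bounds:
  assumes "t \<in> windows k" "i \<in> lows k" "a \<in> starts i" "b \<in> quots k t a"
  shows "len k \<le> b" "level b \<le> k + 1 - i"
proof -
  have i: "1 \<le> i" "i \<le> k" using assms(2) by (auto simp: lows_def)
  have a: "4 ^ i \<le> a" "a \<le> len k"
    using starts_bounds starts_le_len assms by blast+
  have t: "gap k \<le> t" "t + 1 \<le> 16 * gap k" using assms(1) by (auto simp: windows_def)
  have "len k * len k \<le> gap k * len k"
    by (intro mult_le_mono1) (simp add: len_def gap_def)
  also have "\<dots> \<le> t * len k" using t by simp
  also have "\<dots> \<le> a * b" using assms(4) by (simp add: quots_def)
  also have "\<dots> \<le> len k * b" using a by simp
  finally show "len k \<le> b" by simp
  have "4 ^ i * b \<le> a * b" using a by simp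
  also have "\<dots> < (t + 1) * len k" using assms(4) by (simp add: quots_def)
  also have "\<dots> \<le> 16 * gap k * len k" using t by (intro mult_le_mono1)
  also have "\<dots> = 4 ^ (k + 2)" using len_mult_gap[of k] by (simp add: algebra_simps)
  also have "k + 2 = i + Suc (k + 1 - i)" using i by simp
  also have "(4::nat) ^ (i + Suc (k + 1 - i)) = 4 ^ i * 4 ^ Suc (k + 1 - i)" by (rule power_add)
  finally have "b < 4 ^ Suc (k + 1 - i)" by simp
  then show "level b \<le> k + 1 - i" by (rule level_le)
qed

text \<open>A common element would divide a positive number below \<open>len k\<close>.\<close>

lemma quots_disjoint:
  assumes "a < a'" "len k \<le> b" shows "b \<notin> quots k t a \<inter> quots k t a'"
proof
  assume "b \<in> quots k t a \<inter> quots k t a'"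
  then have 1: "t * len k \<le> a * b" "a' * b < t * len k + len k" by (simp_all add: quots_def)
  have "(a + 1) * b \<le> a' * b" using assms(1) by (intro mult_le_mono1) simp
  then show False using 1 assms(2) by simp
qed

text \<open>
  The right-hand side is the expected number of elements of \<open>hits k t\<close> among points drawn
  uniformly from the blocks; each \<open>i \<in> lows k\<close> contributes at least the same amount to it.
\<close>

lemma hit_mass_ge:
  assumes t: "t \<in> windows k"
  shows "3 / 16 / (2 ^ slow k) ^ 3 * real (card (lows k))
    \<le> (\<Sum>p\<in>Sigma {..k} slots. real (card (blk p \<inter> hits k t)) / real (card (blk p)))"
proof -
  \<comment> \<open>For \<open>b \<ge> 1\<close>, the probability that \<open>b\<close> is the point
    drawn from its block.\<close>
  define \<rho> where "\<rho> b = 1 / real (gap (level b))" for b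
  define L where "L = (\<Union>i\<in>lows k. starts i)"
  have hits: "hits k t = (\<Union>a\<in>L. quots k t a)" by (simp add: hits_def L_def)
  have finL: "finite L" by (simp add: L_def)
  have Lpos: "1 \<le> a" "a \<le> len k" if "a \<in> L" for a
  proof -
    from that obtain i where "i \<in> lows k" "a \<in> starts i" by (auto simp: L_def)
    then show "1 \<le> a" "a \<le> len k"
      using starts_bounds(1)[of a i] starts_le_len le_trans[OF one_le_power[of "4::nat" i]] by simp_all
  qed
  \<comment> \<open>There are \<open>3 * len i\<close> choices of \<open>a\<close>; each has at
    least \<open>len k / (2 * 4 ^ Suc i)\<close> cofactors, each of probability at least
    \<open>1 / gap (k + 1 - i)\<close>, where \<open>slow (k + 1 - i)\<close> is bounded by
    \<open>slow k\<close>.\<close>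
  have per_a: "3 * real (len i) * (2 ^ k / 2 ^ slow k / (2 * 4 ^ Suc i) / (2 ^ (k + 1 - i) * 2 ^ slow k))
      \<le> (\<Sum>a\<in>starts i. \<Sum>b\<in>quots k t a. \<rho> b)" if i: "i \<in> lows k" for i
  proof -
    have ik: "1 \<le> i" "i \<le> k" using i by (auto simp: lows_def)
    have "2 ^ k / 2 ^ slow k / (2 * 4 ^ Suc i) / (2 ^ (k + 1 - i) * 2 ^ slow k) \<le> (\<Sum>b\<in>quots k t a. \<rho> b)"
      if a: "a \<in> starts i" for a
    proof -
      have aL: "a \<in> L" using a i by (auto simp: L_def)
      have "real a \<le> 4 ^ Suc i"
        using starts_bounds(2)[OF a] by (metis less_imp_le of_nat_le_iff of_nat_numeral of_nat_power)
      then have "2 ^ k / 2 ^ slow k / (2 * 4 ^ Suc i) \<le> real (len k) / (2 * real a)"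
        unfolding real_len using Lpos[OF aL] by (intro divide_left_mono) auto
      also have "\<dots> \<le> real (card (quots k t a))"
        using card_quots_ge Lpos[OF aL] by blast
      finally have 1: "2 ^ k / 2 ^ slow k / (2 * 4 ^ Suc i) \<le> real (card (quots k t a))" .
      have "1 / (2 ^ (k + 1 - i) * 2 ^ slow k) \<le> \<rho> b" if b: "b \<in> quots k t a" for b
      proof -
        have "real (gap (level b)) \<le> real (gap (k + 1 - i))"
          using quots_bounds(2)[OF t i a b] gap_mono by simp
        also have "\<dots> \<le> 2 ^ (k + 1 - i) * 2 ^ slow k"
          unfolding real_gap using ik by (intro mult_left_mono power_increasing slow_mono) auto
        finally show ?thesis unfolding \<rho>_def by (intro divide_left_mono) auto
      qed
      then have "real (card (quots k t a)) * (1 / (2 ^ (k + 1 - i) * 2 ^ slow k)) \<le> (\<Sum>b\<in>quots k t a. \<rho> b)"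
        by (rule sum_bounded_below)
      moreover have "2 ^ k / 2 ^ slow k / (2 * 4 ^ Suc i) * (1 / (2 ^ (k + 1 - i) * 2 ^ slow k))
          \<le> real (card (quots k t a)) * (1 / (2 ^ (k + 1 - i) * 2 ^ slow k))"
        by (rule mult_right_mono[OF 1]) simp
      ultimately show ?thesis by simp
    qed
    then have "real (card (starts i)) * (2 ^ k / 2 ^ slow k / (2 * 4 ^ Suc i) / (2 ^ (k + 1 - i) * 2 ^ slow k))
        \<le> (\<Sum>a\<in>starts i. \<Sum>b\<in>quots k t a. \<rho> b)"
      by (rule sum_bounded_below)
    then show ?thesis by (simp only: card_starts of_nat_mult of_nat_numeral)
  qed
  have "3 / 16 / (2 ^ slow k) ^ 3 \<le> (\<Sum>a\<in>starts i. \<Sum>b\<in>quots k t a. \<rho> b)" if i: "i \<in> lows k" for i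
  proof -
    have ik: "1 \<le> i" "i \<le> k" using i by (auto simp: lows_def)
    have p: "(2::real) ^ (k + 1 - i) = 2 * 2 ^ k / 2 ^ i"
      using ik power_diff[of "2::real" i "k + 1"] by simp
    have q: "(4::real) ^ i = 2 ^ i * 2 ^ i" by (simp flip: power_mult_distrib)
    \<comment> \<open>All powers \<open>2 ^ i\<close> and \<open>2 ^ k\<close> cancel; the three
      factors \<open>2 ^ slow k\<close> come from \<open>len i\<close>, \<open>len k\<close> and the
      block length.\<close>
    have "(3::real) / 16 / (2 ^ slow k) ^ 3 = 3 * (2 ^ i / 2 ^ slow k) *
        (2 ^ k / 2 ^ slow k / (2 * 4 ^ Suc i) / (2 ^ (k + 1 - i) * 2 ^ slow k))"
      unfolding p by (simp add: q field_simps power3_eq_cube)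
    also have "\<dots> \<le> 3 * real (len i) *
        (2 ^ k / 2 ^ slow k / (2 * 4 ^ Suc i) / (2 ^ (k + 1 - i) * 2 ^ slow k))"
      unfolding real_len using ik
      by (intro mult_right_mono mult_left_mono divide_left_mono power_increasing slow_mono) auto
    also note per_a[OF i]
    finally show ?thesis .
  qed
  then have "real (card (lows k)) * (3 / 16 / (2 ^ slow k) ^ 3)
      \<le> (\<Sum>i\<in>lows k. \<Sum>a\<in>starts i. \<Sum>b\<in>quots k t a. \<rho> b)"
    by (rule sum_bounded_below)
  also have "\<dots> = (\<Sum>a\<in>L. \<Sum>b\<in>quots k t a. \<rho> b)"
    unfolding L_def
  proof (rule sum.UNION_disjoint[symmetric])
    show "\<forall>i\<in>lows k. \<forall>j\<in>lows k. i \<noteq> j \<longrightarrow> starts i \<inter> starts j = {}"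
    proof (intro ballI impI)
      fix i j :: nat assume "i \<noteq> j"
      have "level a = i" if "a \<in> starts i" for a i
        by (intro level_eqI starts_bounds that)
      with \<open>i \<noteq> j\<close> show "starts i \<inter> starts j = {}" by blast
    qed
  qed auto
  \<comment> \<open>Different \<open>a\<close> have disjoint sets of cofactors, so every hit is
    counted once.\<close>
  also have "\<dots> = (\<Sum>b\<in>hits k t. \<rho> b)"
    unfolding hits
  proof (rule sum.UNION_disjoint[symmetric])
    show "\<forall>a\<in>L. \<forall>a'\<in>L. a \<noteq> a' \<longrightarrow> quots k t a \<inter> quots k t a' = {}"
    proof (intro ballI impI)
      fix a a' assume aa: "a \<in> L" "a' \<in> L" "a \<noteq> a'"
      have "len k \<le> b" if "b \<in> quots k t a" for b
        using quots_bounds(1)[OF t] that aa(1) by (auto simp: L_def)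
      moreover from aa(3) have "a < a' \<or> a' < a" by auto
      ultimately show "quots k t a \<inter> quots k t a' = {}"
        using quots_disjoint[of a a' k _ t] quots_disjoint[of a' a k _ t] by blast
    qed
  qed (use finL card_quots_ge(2) Lpos in auto)
  also have "hits k t = (\<Union>p\<in>Sigma {..k} slots. blk p \<inter> hits k t)"
  proof -
    have "\<exists>p\<in>Sigma {..k} slots. b \<in> blk p" if b: "b \<in> hits k t" for b
    proof -
      from b obtain i a where ia: "i \<in> lows k" "a \<in> starts i" "b \<in> quots k t a"
        by (auto simp: hits_def)
      have "level b \<le> k" using quots_bounds(2)[OF t ia] ia(1) by (auto simp: lows_def)
      moreover have "1 \<le> b" using quots_bounds(1)[OF t ia] len_pos[of k] by linarith
      ultimately show ?thesis using div_gap_in_slots[of b] mem_blk[of b "level b"] by blast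
    qed
    then show ?thesis by blast
  qed
  also have "(\<Sum>b\<in>\<dots>. \<rho> b) = (\<Sum>p\<in>Sigma {..k} slots. \<Sum>b\<in>blk p \<inter> hits k t. \<rho> b)"
  proof (rule sum.UNION_disjoint)
    show "\<forall>p\<in>Sigma {..k} slots. \<forall>q\<in>Sigma {..k} slots. p \<noteq> q \<longrightarrow>
        (blk p \<inter> hits k t) \<inter> (blk q \<inter> hits k t) = {}"
    proof (intro ballI impI)
      fix p q assume pq: "p \<in> Sigma {..k} slots" "q \<in> Sigma {..k} slots" "p \<noteq> q"
      have "p = (level b, b div gap (level b))" if "p \<in> Sigma {..k} slots" "b \<in> blk p" for b p
        using that level_blk mem_blk_unique by (cases p) auto
      with pq show "(blk p \<inter> hits k t) \<inter> (blk q \<inter> hits k t) = {}" by blast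
    qed
  qed (auto intro!: finite_SigmaI)
  also have "\<dots> = (\<Sum>p\<in>Sigma {..k} slots. real (card (blk p \<inter> hits k t)) / real (card (blk p)))"
  proof (rule sum.cong[OF refl])
    fix p assume "p \<in> Sigma {..k} slots"
    then have "\<rho> b = 1 / real (card (blk p))" if "b \<in> blk p" for b
      using level_blk that by (auto simp: \<rho>_def card_blk)
    then show "(\<Sum>b\<in>blk p \<inter> hits k t. \<rho> b) = real (card (blk p \<inter> hits k t)) / real (card (blk p))"
      by simp
  qed
  finally show ?thesis by (simp add: mult.commute)
qed

lemma card_lows_ge: "(real k - real (slow k)) / 2 - 2 \<le> real (card (lows k))"
proof -
  have "lows k = {1..(k - slow k) div 2 - 1}" by (auto simp: lows_def)
  then have "card (lows k) = (k - slow k) div 2 - 1" by simp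
  then have "k - slow k \<le> 2 * card (lows k) + 3" by presburger
  then have "real (k - slow k) \<le> 2 * real (card (lows k)) + 3" by linarith
  then show ?thesis using slow_le[of k] by (simp add: of_nat_diff field_simps)
qed

subsection \<open>Counting, and the theorem\<close>

definition profile :: "real \<Rightarrow> real \<Rightarrow> real" where
  "profile c X = 2 * c * sqrt X / (ln X) powr (1/4)"

lemma finite_counted: "finite {n \<in> A. 1 \<le> n \<and> real n \<le> X}"
proof (rule finite_subset)
  show "{n \<in> A. 1 \<le> n \<and> real n \<le> X} \<subseteq> {..nat \<lfloor>X\<rfloor>}"
    by (auto simp: le_nat_floor)
qed simp

lemma countfn_mono: "A \<subseteq> A' \<Longrightarrow> countfn A X \<le> countfn A' X"
  unfolding countfn_def by (intro card_mono finite_counted) auto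

lemma countfn_Un_le: "countfn (A \<union> A') X \<le> countfn A X + countfn A' X"
proof -
  have "countfn (A \<union> A') X = card ({n \<in> A. 1 \<le> n \<and> real n \<le> X} \<union> {n \<in> A'. 1 \<le> n \<and> real n \<le> X})"
    unfolding countfn_def by (rule arg_cong[where f = card]) auto
  then show ?thesis unfolding countfn_def by (simp add: card_Un_le)
qed

lemma mult_in_prodsetI: "x \<in> A \<Longrightarrow> y \<in> A \<Longrightarrow> x * y \<in> prodset A"
  unfolding prodset_def by blast

lemma one_in_prodsetI: "1 \<in> A \<Longrightarrow> x \<in> A \<Longrightarrow> x \<in> prodset A"
  using mult_in_prodsetI[of 1 A x] by simp

lemma add_in_sumsetI: "x \<in> B \<Longrightarrow> y \<in> C \<Longrightarrow> x + y \<in> sumset B C"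
  unfolding sumset_def by blast

section \<open>From windows to all nonnegative integers\<close>

text \<open>Subtracting from \<open>n\<close> a product in a suitable window leaves a remainder in
  the interval at \<open>4 ^ k\<close>, which is a product because \<open>1 \<in> A\<close>.\<close>

lemma sumset_prodset_UNIV:
  assumes "0 \<in> A" and diff: "\<And>k. {4 ^ k..<4 ^ k + 2 * len k} \<subseteq> A"
    and window: "\<And>k t. t \<in> windows k \<Longrightarrow> \<exists>p\<in>prodset A. t * len k \<le> p \<and> p < (t + 1) * len k"
  shows "sumset (prodset A) (prodset A) = UNIV"
proof -
  have one: "1 \<in> A" using diff[of 0] by (auto simp: len_def)
  have "n \<in> sumset (prodset A) (prodset A)" for n
  proof (cases "n < 3")
    case True
    then have "n = 0 + 0 \<or> n = 1 + 0 \<or> n = 1 + (1::nat)" by auto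
    then show ?thesis
      using one_in_prodsetI[OF one one] one_in_prodsetI[OF one assms(1)]
      by (elim disjE) (simp_all only: add_in_sumsetI)
  next
    case False
    \<comment> \<open>With \<open>3 * 4 ^ k \<le> n < 12 * 4 ^ k\<close>, subtracting
      \<open>4 ^ k + len k\<close> leaves \<open>y\<close> in the range covered by the
      windows.\<close>
    define k where "k = level (n div 3)"
    have k: "4 ^ k \<le> n div 3" "n div 3 < 4 ^ Suc k"
      unfolding k_def using False by (intro power_level_le less_power_level; simp)+
    have len_le': "len k \<le> 4 ^ k"
      using len_le[of k] power_mono[of 2 "4::nat" k] by simp
    \<comment> \<open>The shift by \<open>len k\<close> centres the remainder: \<open>p\<close> and
      \<open>y\<close> share a window, so \<open>n - p\<close> differs from
      \<open>4 ^ k + len k\<close> by less than \<open>len k\<close>.\<close>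
    define y where "y = n - 4 ^ k - len k"
    have y: "4 ^ k \<le> y" "y < 16 * 4 ^ k" "n = y + 4 ^ k + len k"
      unfolding y_def using k len_le' by auto
    define t where "t = y div len k"
    have t: "t * len k \<le> y" "y < (t + 1) * len k"
      unfolding t_def using dividend_less_div_times[of "len k" y] by simp_all
    have "gap k \<le> t"
      unfolding t_def using y(1) by (simp add: less_eq_div_iff_mult_less_eq len_mult_gap mult.commute[of "gap k"])
    moreover have "t < 16 * gap k"
      unfolding t_def using y(2) len_mult_gap[of k] by (simp add: div_less_iff_less_mult ac_simps)
    ultimately obtain p where p: "p \<in> prodset A" "t * len k \<le> p" "p < (t + 1) * len k"
      using window[of t k] by (auto simp: windows_def)
    have "n - p \<in> {4 ^ k..<4 ^ k + 2 * len k}" and "p \<le> n"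
      using p t y(3) by auto
    then show ?thesis
      using add_in_sumsetI[OF p(1) one_in_prodsetI[OF one]] diff[of k] by fastforce
  qed
  then show ?thesis by blast
qed

text \<open>The selection lemma is applied with windows as targets and the blocks of level at most
  \<open>k\<close> as sources. At most \<open>C * len k\<close> windows are missed, so repairing
  them one by one keeps \<open>T k\<close> of size \<open>O(len k)\<close>.\<close>

lemma exists_thin_basis:
  "\<exists>(T :: nat \<Rightarrow> nat set) K.
     (\<forall>k. finite (T k) \<and> (\<forall>n\<in>T k. 4 ^ k \<le> n) \<and> real (card (T k)) \<le> K * real (len k)) \<and>
     (\<forall>A. insert 0 (\<Union>k. T k) \<subseteq> A \<longrightarrow> sumset (prodset A) (prodset A) = UNIV)"
proof -
  define e where "e k = exp (- (3 / 16 / (2 ^ slow k) ^ 3 * ((real k - real (slow k)) / 2 - 2)))" for k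
  let ?J = "\<lambda>k. Sigma {..k} slots"
  have "\<exists>f C. (\<forall>p. f p \<in> blk p) \<and>
      (\<forall>k. 1 / real (len k) * real (card {t \<in> windows k. \<forall>p\<in>?J k. f p \<notin> hits k t}) \<le> C)"
  proof (rule exists_selection_few_misses)
    fix k t assume t: "t \<in> windows k"
    let ?x = "\<lambda>p. real (card (blk p \<inter> hits k t)) / real (card (blk p))"
    \<comment> \<open>The inequality \<open>1 - x \<le> exp (- x)\<close> reduces the miss
      probability to the expected number of hits.\<close>
    have "(\<Prod>p\<in>?J k. 1 - ?x p) \<le> (\<Prod>p\<in>?J k. exp (- ?x p))"
    proof (intro prod_mono conjI)
      fix p
      show "0 \<le> 1 - ?x p"
        using card_mono[OF finite_blk, of "blk p \<inter> hits k t" p] by (simp add: divide_le_eq)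
      show "1 - ?x p \<le> exp (- ?x p)"
        using exp_ge_add_one_self[of "- ?x p"] by simp
    qed
    also have "\<dots> = exp (- (\<Sum>p\<in>?J k. ?x p))"
      by (subst exp_sum[symmetric]) (auto simp: sum_negf)
    also have "\<dots> \<le> e k"
    proof -
      have "3 / 16 / (2 ^ slow k) ^ 3 * ((real k - real (slow k)) / 2 - 2)
          \<le> 3 / 16 / (2 ^ slow k) ^ 3 * real (card (lows k))"
        by (rule mult_left_mono[OF card_lows_ge]) simp
      also have "\<dots> \<le> (\<Sum>p\<in>?J k. ?x p)" by (rule hit_mass_ge[OF t])
      finally show ?thesis by (simp add: e_def)
    qed
    finally show "(\<Prod>p\<in>?J k. 1 - ?x p) \<le> e k" .
  next
    show "summable (\<lambda>k. 1 / real (len k) * (real (card (windows k)) * e k))"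
      using summable_miss_probability unfolding e_def windows_def .
  qed (auto simp: blk_nonempty windows_def e_def)
  then obtain f C where f: "\<And>p. f p \<in> blk p"
    and C: "\<And>k. 1 / real (len k) * real (card {t \<in> windows k. \<forall>p\<in>?J k. f p \<notin> hits k t}) \<le> C"
    by blast
  define miss where "miss k = {t \<in> windows k. \<forall>p\<in>?J k. f p \<notin> hits k t}" for k
  \<comment> \<open>In order: the progression, the random points, the interval supplying the second
    summand, and the left end points of missed windows.\<close>
  define T where "T k = (starts k \<union> (\<lambda>r. f (k, r)) ` slots k) \<union>
      ({4 ^ k..<4 ^ k + 2 * len k} \<union> (\<lambda>t. t * len k) ` miss k)" for k
  have fin_miss: "finite (miss k)" for k by (simp add: miss_def windows_def)
  have "finite (T k)" for k
    by (simp add: T_def fin_miss)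
  moreover have "4 ^ k \<le> n" if "n \<in> T k" for k n
  proof -
    have "4 ^ k \<le> t * len k" if "t \<in> miss k" for t
    proof -
      have "gap k * len k \<le> t * len k"
        using that by (intro mult_le_mono1) (simp add: miss_def windows_def)
      then show ?thesis using len_mult_gap[of k] by (metis mult.commute)
    qed
    moreover have "4 ^ k \<le> f (k, r)" if "r \<in> slots k" for r
      by (rule blk_bounds(1)[OF that f])
    moreover have "4 ^ k \<le> a" if "a \<in> starts k" for a
      by (rule starts_bounds(1)[OF that])
    moreover from that have "n \<in> starts k \<or> n \<in> (\<lambda>r. f (k, r)) ` slots k \<or>
        n \<in> {4 ^ k..<4 ^ k + 2 * len k} \<or> n \<in> (\<lambda>t. t * len k) ` miss k"
      by (simp only: T_def Un_iff disj_assoc)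
    ultimately show ?thesis by (elim disjE imageE) simp_all
  qed
  moreover have "real (card (T k)) \<le> (8 + C) * real (len k)" for k
  proof -
    have "card (T k) \<le> (card (starts k) + card ((\<lambda>r. f (k, r)) ` slots k)) +
        (card {4 ^ k..<4 ^ k + 2 * len k} + card ((\<lambda>t. t * len k) ` miss k))"
      unfolding T_def by (intro order_trans[OF card_Un_le] add_mono card_Un_le)
    also have "\<dots> \<le> (3 * len k + 3 * len k) + (2 * len k + card (miss k))"
    proof (intro add_mono)
      show "card ((\<lambda>r. f (k, r)) ` slots k) \<le> 3 * len k"
        using card_image_le[OF finite_slots, of "\<lambda>r. f (k, r)" k] by (simp add: slots_def)
    qed (auto simp: card_starts card_image_le fin_miss)
    finally have "real (card (T k)) \<le> 8 * real (len k) + real (card (miss k))" by linarith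
    moreover have "real (card (miss k)) \<le> C * real (len k)"
      using C[of k] by (simp add: miss_def divide_le_eq)
    ultimately show ?thesis by (simp add: algebra_simps)
  qed
  moreover have "sumset (prodset A) (prodset A) = UNIV" if A: "insert 0 (\<Union>k. T k) \<subseteq> A" for A
  proof (rule sumset_prodset_UNIV)
    show "0 \<in> A" using A by simp
    show diff: "{4 ^ k..<4 ^ k + 2 * len k} \<subseteq> A" for k
      using A by (auto simp: T_def)
    have one: "1 \<in> A" using diff[of 0] by (auto simp: len_def)
    fix k t assume t: "t \<in> windows k"
    show "\<exists>p\<in>prodset A. t * len k \<le> p \<and> p < (t + 1) * len k"
    proof (cases "t \<in> miss k")
      case True
      then have "t * len k \<in> T k" unfolding T_def by (intro UnI2 imageI)
      then have "t * len k \<in> prodset A" using A by (intro one_in_prodsetI[OF one]) blast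
      then show ?thesis by (intro bexI[of _ "t * len k"]) auto
    next
      case False
      with t have "\<exists>p\<in>?J k. f p \<in> hits k t" unfolding miss_def by blast
      then obtain j r where jr: "r \<in> slots j" "f (j, r) \<in> hits k t" by blast
      then obtain i a where a: "a \<in> starts i" "f (j, r) \<in> quots k t a"
        unfolding hits_def by blast
      have "a \<in> T i" "f (j, r) \<in> T j"
        using a(1) jr(1) unfolding T_def by blast+
      then have "a * f (j, r) \<in> prodset A" using A by (intro mult_in_prodsetI) blast+
      then show ?thesis using a(2) by (auto simp: quots_def)
    qed
  qed
  ultimately show ?thesis by (intro exI[of _ T] exI[of _ "8 + C"]) blast
qed

text \<open>Only levels with \<open>4 ^ k \<le> X\<close> contribute, so \<open>sum_len_le\<close>
  bounds the count by a multiple of \<open>sqrt X / (ln X) powr (2/7)\<close>, and 2/7 exceeds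
  1/4.\<close>

lemma countfn_thin_smallo:
  fixes T :: "nat \<Rightarrow> nat set"
  assumes fin: "\<And>k. finite (T k)" and ge: "\<And>k n. n \<in> T k \<Longrightarrow> 4 ^ k \<le> n"
    and card: "\<And>k. real (card (T k)) \<le> K * real (len k)" and "c > 0"
  shows "(\<lambda>X. real (countfn (insert 0 (\<Union>k. T k)) X)) \<in> o(profile c)"
proof -
  have K: "0 \<le> K"
    using order_trans[OF of_nat_0_le_iff card[of 0]] len_pos[of 0] by (simp add: zero_le_mult_iff)
  have bound: "real (countfn (insert 0 (\<Union>k. T k)) X) \<le> K * (8 * sqrt X / (ln X / ln 4) powr (2/7))"
    if X: "1 < X" for X
  proof -
    define n where "n = level (nat \<lfloor>X\<rfloor>)"
    have n: "4 ^ n \<le> nat \<lfloor>X\<rfloor>" "nat \<lfloor>X\<rfloor> < 4 ^ Suc n"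
      unfolding n_def using X by (intro power_level_le less_power_level; simp add: le_nat_floor)+
    have n': "4 ^ n \<le> X" "X < 4 ^ Suc n"
    proof -
      have "real (4 ^ n) \<le> real (nat \<lfloor>X\<rfloor>)" using n(1) by (simp only: of_nat_le_iff)
      also have "\<dots> \<le> X" using X by simp
      finally show "4 ^ n \<le> X" by simp
      have "X < real (nat \<lfloor>X\<rfloor> + 1)" using X by (simp add: of_nat_nat) linarith
      also have "\<dots> \<le> real (4 ^ Suc n)" using n(2) by (simp only: of_nat_le_iff)
      finally show "X < 4 ^ Suc n" by simp
    qed
    have "countfn (insert 0 (\<Union>k. T k)) X \<le> card (\<Union>k\<le>n. T k)"
      unfolding countfn_def
    proof (intro card_mono)
      show "{m \<in> insert 0 (\<Union>k. T k). 1 \<le> m \<and> real m \<le> X} \<subseteq> (\<Union>k\<le>n. T k)"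
      proof
        fix m assume "m \<in> {m \<in> insert 0 (\<Union>k. T k). 1 \<le> m \<and> real m \<le> X}"
        then obtain k where k: "m \<in> T k" "real m \<le> X" by auto
        have "(4::real) ^ k \<le> real m" using ge[OF k(1)] by (metis of_nat_le_iff of_nat_numeral of_nat_power)
        then have "(4::real) ^ k < 4 ^ Suc n" using k(2) n'(2) by linarith
        then have "k \<le> n" by (simp only: power_strict_increasing_iff less_Suc_eq_le)
        with k show "m \<in> (\<Union>k\<le>n. T k)" by blast
      qed
    qed (use fin in auto)
    also have "\<dots> \<le> (\<Sum>k\<le>n. card (T k))"
      by (rule card_UN_le) simp
    finally have "real (countfn (insert 0 (\<Union>k. T k)) X) \<le> (\<Sum>k\<le>n. real (card (T k)))"
      by (metis of_nat_le_iff of_nat_sum)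
    also have "\<dots> \<le> (\<Sum>k\<le>n. K * real (len k))" by (intro sum_mono card)
    also have "\<dots> = K * (\<Sum>k\<le>n. real (len k))" by (simp add: sum_distrib_left)
    also have "\<dots> \<le> K * (8 * 2 ^ n / real (n + 1) powr (2/7))"
      by (intro mult_left_mono sum_len_le K)
    also have "\<dots> \<le> K * (8 * sqrt X / (ln X / ln 4) powr (2/7))"
    proof (rule mult_left_mono[OF frac_le K])
      have "(2 ^ n)\<^sup>2 \<le> X" using n'(1) by (simp add: power2_eq_square flip: power_mult_distrib)
      then show "8 * 2 ^ n \<le> 8 * sqrt X" by (simp add: real_le_rsqrt)
      have "ln X \<le> ln (4 ^ Suc n)" using X n'(2) by simp
      also have "\<dots> = real (n + 1) * ln 4" by (subst ln_realpow) auto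
      finally have "ln X / ln 4 \<le> real (n + 1)" by (simp add: divide_le_eq)
      then show "(ln X / ln 4) powr (2/7) \<le> real (n + 1) powr (2/7)"
        using X by (intro powr_mono2) auto
      have "ln X > 0" using X by simp
      then show "0 < (ln X / ln 4) powr (2/7)" by simp
    qed (use X in auto)
    finally show ?thesis .
  qed
  have "(\<lambda>X. real (countfn (insert 0 (\<Union>k. T k)) X)) \<in> O(\<lambda>X. K * (8 * sqrt X / (ln X / ln 4) powr (2/7)))"
  proof (rule landau_o.big_mono)
    show "\<forall>\<^sub>F X in at_top. norm (real (countfn (insert 0 (\<Union>k. T k)) X))
        \<le> norm (K * (8 * sqrt X / (ln X / ln 4) powr (2/7)))"
      using eventually_gt_at_top[of 1] 
    proof eventually_elim
      case (elim X)
      from bound[OF this] show ?case unfolding real_norm_def by linarith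
    qed
  qed
  also have "(\<lambda>X. K * (8 * sqrt X / (ln X / ln 4) powr (2/7))) \<in> o(profile c)"
    unfolding profile_def using \<open>c > 0\<close> by real_asymp
  finally show ?thesis .
qed

text \<open>The set collects the places where the floor of the profile jumps.\<close>

lemma exists_set_with_profile:
  assumes "c > 0"
  shows "\<exists>G. (\<lambda>X. real (countfn G X)) \<sim>[at_top] profile c"
proof -
  let ?g = "\<lambda>n::nat. profile c (real n)"
  \<comment> \<open>Eventually the profile increases by between 0 and 1 per step, so its floor
    increases by 0 or 1 and the number of jumps telescopes.\<close>
  have "eventually (\<lambda>x. profile c x \<le> profile c (x + 1)) at_top"
    unfolding profile_def using assms by real_asymp
  moreover have "eventually (\<lambda>x. profile c (x + 1) \<le> profile c x + 1) at_top"
    unfolding profile_def using assms by real_asymp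
  ultimately have "eventually (\<lambda>x. profile c x \<le> profile c (x + 1) \<and> profile c (x + 1) \<le> profile c x + 1) at_top"
    by (rule eventually_conj)
  from eventually_compose_filterlim[OF this filterlim_real_sequentially]
  obtain N where N: "\<And>n. n \<ge> N \<Longrightarrow> ?g n \<le> ?g (n + 1) \<and> ?g (n + 1) \<le> ?g n + 1"
    unfolding eventually_sequentially by (auto simp: add.commute)
  define G where "G = {n. N \<le> n \<and> 1 \<le> n \<and> \<lfloor>?g n\<rfloor> < \<lfloor>?g (n + 1)\<rfloor>}"
  have card_G: "int (card {n \<in> G. n < M}) = \<lfloor>?g M\<rfloor> - \<lfloor>?g (max N 1)\<rfloor>" if "max N 1 \<le> M" for M
    using that
  proof (induction M rule: dec_induct)
    case base
    have "{n \<in> G. n < max N 1} = {}" by (auto simp: G_def)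
    then show ?case by simp
  next
    case (step M)
    have eq: "{n \<in> G. n < Suc M} = (if M \<in> G then insert M {n \<in> G. n < M} else {n \<in> G. n < M})"
      by (auto simp: less_Suc_eq)
    have "\<lfloor>?g M\<rfloor> \<le> \<lfloor>?g (M + 1)\<rfloor>" "\<lfloor>?g (M + 1)\<rfloor> \<le> \<lfloor>?g M\<rfloor> + 1"
      using N[of M] step.hyps floor_mono[of "?g (M + 1)" "?g M + 1"] by (auto intro: floor_mono)
    then have "int (card {n \<in> G. n < Suc M}) = int (card {n \<in> G. n < M}) + (\<lfloor>?g (M + 1)\<rfloor> - \<lfloor>?g M\<rfloor>)"
      unfolding eq using step.hyps by (auto simp: G_def)
    then show ?case using step.IH by simp
  qed
  \<comment> \<open>The elements \<open>n \<le> X\<close> are those below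
    \<open>\<lfloor>X\<rfloor> + 1\<close>, hence the telescoped count involves the profile there,
    up to a bounded error.\<close>
  let ?h = "\<lambda>X. profile c (real_of_int \<lfloor>X\<rfloor> + 1)"
  have "eventually (\<lambda>X. \<bar>real (countfn G X) - ?h X\<bar> \<le> \<bar>real_of_int \<lfloor>?g (max N 1)\<rfloor>\<bar> + 1) at_top"
    using eventually_ge_at_top[of "real (max N 1)"]
  proof eventually_elim
    case (elim X)
    then have X: "1 \<le> X" by simp
    define M where "M = nat \<lfloor>X\<rfloor> + 1"
    have M: "real M = real_of_int \<lfloor>X\<rfloor> + 1" using X by (simp add: M_def of_nat_nat)
    have "real n \<le> X \<longleftrightarrow> n < M" for n
      unfolding M_def using X by (simp add: le_nat_floor less_Suc_eq_le le_nat_iff le_floor_iff)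
    then have "countfn G X = card {n \<in> G. n < M}"
      unfolding countfn_def by (intro arg_cong[where f = card]) (auto simp: G_def)
    moreover have "real (max N 1) < real M" using elim M by linarith
    then have "max N 1 \<le> M" by linarith
    ultimately have "int (countfn G X) = \<lfloor>?g M\<rfloor> - \<lfloor>?g (max N 1)\<rfloor>"
      using card_G[of M] by simp
    then have "real (countfn G X) = real_of_int \<lfloor>?g M\<rfloor> - real_of_int \<lfloor>?g (max N 1)\<rfloor>"
      by (metis of_int_diff of_int_of_nat_eq)
    then show ?case unfolding M[symmetric] by linarith
  qed
  then have "(\<lambda>X. real (countfn G X) - ?h X) \<in> O(\<lambda>_. 1)"
    by (intro bigoI[of _ "\<bar>real_of_int \<lfloor>?g (max N 1)\<rfloor>\<bar> + 1"]) simp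
  also have "(\<lambda>_. 1) \<in> o(profile c)"
    unfolding profile_def using assms by real_asymp
  finally have "(\<lambda>X. real (countfn G X) - ?h X) \<in> o(profile c)" .
  moreover have "?h \<sim>[at_top] profile c"
    unfolding profile_def using assms by real_asymp
  ultimately have "(\<lambda>X. ?h X + (real (countfn G X) - ?h X)) \<sim>[at_top] profile c"
    by (subst asymp_equiv_add_right)
  then show ?thesis by auto
qed

theorem theorem6p8:
  fixes c :: real
  assumes "c > (4 * pi / 3) powr (1/4)"
  shows "\<exists>A :: nat set. sumset (prodset A) (prodset A) = UNIV \<and>
           (\<lambda>X. real (countfn A X)) \<sim>[at_top] (\<lambda>X. 2 * c * sqrt X / (ln X) powr (1/4))"
proof -
  have c: "c > 0" using assms powr_ge_zero[of "4 * pi / 3" "1/4"] by linarith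
  obtain T K where T: "\<And>k. finite (T k)" "\<And>k n. n \<in> T k \<Longrightarrow> 4 ^ k \<le> n"
      "\<And>k. real (card (T k)) \<le> K * real (len k)"
    and basis: "\<And>A. insert 0 (\<Union>k. T k) \<subseteq> A \<Longrightarrow> sumset (prodset A) (prodset A) = UNIV"
    using exists_thin_basis by metis
  obtain G where G: "(\<lambda>X. real (countfn G X)) \<sim>[at_top] profile c"
    using exists_set_with_profile[OF c] by blast
  let ?A0 = "insert 0 (\<Union>k. T k)"
  \<comment> \<open>The elements contributed by \<open>?A0\<close> outside \<open>G\<close>: between
    0 and \<open>countfn ?A0 X\<close> of them, hence negligible against the profile.\<close>
  let ?r = "\<lambda>X. real (countfn (G \<union> ?A0) X) - real (countfn G X)"
  have "?r \<in> O(\<lambda>X. real (countfn ?A0 X))"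
  proof (rule landau_o.big_mono, rule always_eventually, rule allI)
    fix X
    show "norm (?r X) \<le> norm (real (countfn ?A0 X))"
      using countfn_Un_le[of G ?A0 X] countfn_mono[OF Un_upper1[of G ?A0], of X]
      unfolding real_norm_def by linarith
  qed
  also have "(\<lambda>X. real (countfn ?A0 X)) \<in> o(profile c)"
    using T c by (rule countfn_thin_smallo)
  finally have "(\<lambda>X. real (countfn G X) + ?r X) \<sim>[at_top] profile c"
    using G by (subst asymp_equiv_add_right)
  then have "(\<lambda>X. real (countfn (G \<union> ?A0) X)) \<sim>[at_top] (\<lambda>X. 2 * c * sqrt X / (ln X) powr (1/4))"
    by (simp add: profile_def[abs_def])
  moreover have "sumset (prodset (G \<union> ?A0)) (prodset (G \<union> ?A0)) = UNIV"
    by (rule basis) auto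
  ultimately show ?thesis by blast
qed

end
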